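(* Let $u_h,w_h\in\mathbb{V}_h$ with $u_h\le w_h$ on the boundary $\partial\Omega_h$ be such that $$T_\varepsilon[u_h](x_i)\ge T_\varepsilon[w_h](x_i)\ge 0\qquad\forall\,x_i\in\mathcal{N}_h^0.$$ Then $u_h\le w_h$ in $\Omega_h$.
   Context: Setting. $d\ge 2$; $\Omega\subset\mathbb{R}^d$ is a bounded uniformly convex domain. $\mathcal{T}_h$ is a (shape-regular, quasi-uniform) conforming simplicial triangulation with mesh size $h$; $\Omega_h$ is the union of its elements; $\mathcal{N}_h$ is the set of nodes (vertices), $\mathcal{N}_h^b=\mathcal{N}_h\cap\partial\Omega_h$ the boundary nodes, $\mathcal{N}_h^0=\mathcal{N}_h\setminus\mathcal{N}_h^b$ the interior nodes. It is assumed that $\mathcal{N}_h^b\subset\partial\Omega$, that $\Omega_h$ is convex and $\Omega_h\subset\Omega$. $\mathbb{V}_h$ is the space of continuous functions on $\overline\Omega_h$ that are affine on each element of $\mathcal{T}_h$. Discrete operator. Fix $\delta>0$, $\theta>0$ and write $\varepsilon=(h,\delta,\theta)$. $\mathbb{S}$ is the unit sphere of $\mathbb{R}^d$ and $\mathbb{S}^\perp$ the set of orthonormal bases $\mathbf{v}=(v_1,\dots,v_d)$ of $\mathbb{R}^d$. $\mathbb{S}_\theta\subset\mathbb{S}$ is a finite set such that every $v\in\mathbb{S}$ is within distance $\theta$ of some element of $\mathbb{S}_\theta$, and $\mathbb{S}^\perp_\theta\subset\mathbb{S}^\perp$ is a finite set of orthonormal bases with all components in $\mathbb{S}_\theta$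 such that for every $\mathbf{v}\in\mathbb{S}^\perp$ there is $\mathbf{v}^\theta\in\mathbb{S}^\perp_\theta$ with $|v_j-v_j^\theta|\le\theta$ for all $j$. For $x_i\in\mathcal{N}_h^0$, $v\in\mathbb{S}$ and continuous $w$, $$\nabla^2_\delta w(x_i;v)=\frac{w(x_i+\rho\delta v)-2w(x_i)+w(x_i-\rho\delta v)}{\rho^2\delta^2},$$ where $\rho=\rho(x_i)\in(0,1]$ is the largest number with $x_i\pm\rho\delta v\in\overline\Omega_h$ for all $v\in\mathbb{S}$. Set $\nabla^{2,+}_\delta w=\max(\nabla^2_\delta w,0)$, $\nabla^{2,-}_\delta w=-\min(\nabla^2_\delta w,0)$ and $$T_\varepsilon[w](x_i)=\min_{\mathbf{v}\in\mathbb{S}^\perp_\theta}\Big(\prod_{j=1}^d\nabla^{2,+}_\delta w(x_i;v_j)-\sum_{j=1}^d\nabla^{2,-}_\delta w(x_i;v_j)\Big).$$ *)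

theory Defs
  imports "HOL-Analysis.Analysis"
begin

(* No smoothness of the boundary is presupposed: uniform convexity is the enclosing ball condition,
   which for C^2 boundaries says that all principal curvatures are bounded below by 1/R. *)
definition uniformly_convex_domain :: "(real^'n) set \<Rightarrow> bool" where
  "uniformly_convex_domain \<Omega> \<longleftrightarrow>
     open \<Omega> \<and> connected \<Omega> \<and> \<Omega> \<noteq> {} \<and> convex \<Omega> \<and>
     (\<exists>R>0. \<forall>x\<in>frontier \<Omega>. \<exists>z. dist x z = R \<and> \<Omega> \<subseteq> cball z R)"

(* Elements are closed simplices; conformity (elements meet in common faces) is part of
   the library notion triangulation. *)
definition conforming_mesh :: "(real^'n) set set \<Rightarrow> bool" where
  "conforming_mesh \<T> \<longleftrightarrow>
     \<T> \<noteq> {} \<and> triangulation \<T> \<and> (\<forall>K\<in>\<T>. int CARD('n) simplex K)"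

definition mesh_size :: "(real^'n) set set \<Rightarrow> real" where
  "mesh_size \<T> = (MAX K\<in>\<T>. diameter K)"

definition inradius :: "(real^'n) set \<Rightarrow> real" where
  "inradius K = Sup {r. 0 \<le> r \<and> (\<exists>z. cball z r \<subseteq> K)}"

definition shape_regular :: "real \<Rightarrow> (real^'n) set set \<Rightarrow> bool" where
  "shape_regular \<sigma> \<T> \<longleftrightarrow> (\<forall>K\<in>\<T>. diameter K \<le> \<sigma> * inradius K)"

definition quasi_uniform :: "real \<Rightarrow> (real^'n) set set \<Rightarrow> bool" where
  "quasi_uniform c \<T> \<longleftrightarrow> (\<forall>K\<in>\<T>. mesh_size \<T> \<le> c * diameter K)"

(* The computational domain is the open set covered by the mesh. It has to be open: the closed
   union of the elements contains the boundary nodes, which lie on the boundary of the open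
   set Omega, and hence could not be a subset of Omega. For full-dimensional simplices its
   closure is the closed union. *)
definition mesh_domain :: "(real^'n) set set \<Rightarrow> (real^'n) set" where
  "mesh_domain \<T> = interior (\<Union>\<T>)"

definition nodes :: "(real^'n) set set \<Rightarrow> (real^'n) set" where
  "nodes \<T> = {x. \<exists>K\<in>\<T>. x extreme_point_of K}"

definition boundary_nodes :: "(real^'n) set set \<Rightarrow> (real^'n) set" where
  "boundary_nodes \<T> = nodes \<T> \<inter> frontier (mesh_domain \<T>)"

definition interior_nodes :: "(real^'n) set set \<Rightarrow> (real^'n) set" where
  "interior_nodes \<T> = nodes \<T> - boundary_nodes \<T>"

(* Members are total functions on the whole space; only their values on the closure of the mesh domain matter. *)
definition fe_space :: "(real^'n) set set \<Rightarrow> (real^'n \<Rightarrow> real) set" where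
  "fe_space \<T> = {w. continuous_on (closure (mesh_domain \<T>)) w \<and>
     (\<forall>K\<in>\<T>. \<exists>a b. \<forall>x\<in>K. w x = a \<bullet> x + b)}"

definition orthonormal_bases :: "('n \<Rightarrow> real^'n) set" where
  "orthonormal_bases =
     {v. (\<forall>i j. v i \<bullet> v j = (if i = j then 1 else 0)) \<and> span (range v) = UNIV}"

definition direction_net :: "real \<Rightarrow> (real^'n) set \<Rightarrow> bool" where
  "direction_net \<theta> S \<longleftrightarrow>
     finite S \<and> S \<subseteq> sphere 0 1 \<and> (\<forall>v\<in>sphere 0 1. \<exists>v'\<in>S. dist v v' \<le> \<theta>)"

definition basis_net :: "real \<Rightarrow> (real^'n) set \<Rightarrow> ('n \<Rightarrow> real^'n) set \<Rightarrow> bool" where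
  "basis_net \<theta> S B \<longleftrightarrow>
     finite B \<and> B \<subseteq> orthonormal_bases \<and> (\<forall>v\<in>B. \<forall>j. v j \<in> S) \<and>
     (\<forall>v\<in>orthonormal_bases. \<exists>v'\<in>B. \<forall>j. norm (v j - v' j) \<le> \<theta>)"

definition step_factor :: "(real^'n) set set \<Rightarrow> real \<Rightarrow> real^'n \<Rightarrow> real" where
  "step_factor \<T> \<delta> x = (GREATEST \<rho>. 0 < \<rho> \<and> \<rho> \<le> 1 \<and>
     (\<forall>v\<in>sphere 0 1. x + (\<rho> * \<delta>) *\<^sub>R v \<in> closure (mesh_domain \<T>) \<and>
                    x - (\<rho> * \<delta>) *\<^sub>R v \<in> closure (mesh_domain \<T>)))"

definition second_diff ::
  "(real^'n) set set \<Rightarrow> real \<Rightarrow> (real^'n \<Rightarrow> real) \<Rightarrow> real^'n \<Rightarrow> real^'n \<Rightarrow> real" where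
  "second_diff \<T> \<delta> w x v = (let \<rho> = step_factor \<T> \<delta> x in
     (w (x + (\<rho> * \<delta>) *\<^sub>R v) - 2 * w x + w (x - (\<rho> * \<delta>) *\<^sub>R v)) / (\<rho>^2 * \<delta>^2))"

definition second_diff_pos ::
  "(real^'n) set set \<Rightarrow> real \<Rightarrow> (real^'n \<Rightarrow> real) \<Rightarrow> real^'n \<Rightarrow> real^'n \<Rightarrow> real" where
  "second_diff_pos \<T> \<delta> w x v = max (second_diff \<T> \<delta> w x v) 0"

definition second_diff_neg ::
  "(real^'n) set set \<Rightarrow> real \<Rightarrow> (real^'n \<Rightarrow> real) \<Rightarrow> real^'n \<Rightarrow> real^'n \<Rightarrow> real" where
  "second_diff_neg \<T> \<delta> w x v = - min (second_diff \<T> \<delta> w x v) 0"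

(* The dependence on the mesh size and on theta is through the mesh and through the
   finite set B of orthonormal bases. *)
definition discrete_MA ::
  "(real^'n) set set \<Rightarrow> real \<Rightarrow> ('n \<Rightarrow> real^'n) set \<Rightarrow> (real^'n \<Rightarrow> real) \<Rightarrow> real^'n \<Rightarrow> real" where
  "discrete_MA \<T> \<delta> B w x =
     (MIN v\<in>B. (\<Prod>j\<in>UNIV. second_diff_pos \<T> \<delta> w x (v j))
              - (\<Sum>j\<in>UNIV. second_diff_neg \<T> \<delta> w x (v j)))"

end

theory Submission
  imports Defs
begin

text \<open>The function $u + \alpha |x|^2 - w$ is convex on every element, so its maximum over the mesh is
  attained at a node, and no interpolation of the strictly convex perturbation is needed. At an
  interior maximum node all second differences of $w$ exceed those of $u$ by at least $2\alpha$.
  Nonnegativity of the operator excludes negative second differences of $u$, so the product for $w$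
  is strictly larger than that for $u$ in every basis of the net, contradicting the operator
  inequality. At a boundary node the boundary condition applies once $\alpha$ is small.\<close>

section \<open>Convexity and second differences of the quadratic perturbation\<close>

lemma convex_on_inner_self:
  fixes S :: "'a::real_inner set"
  assumes "convex S"
  shows "convex_on S (\<lambda>x. x \<bullet> x)"
proof (rule convex_onI)
  fix t :: real and x y :: 'a
  assume "0 < t" "t < 1"
  then have "0 \<le> t * (1 - t) * ((x - y) \<bullet> (x - y))"
    by (simp add: mult_nonneg_nonneg)
  \<comment> \<open>The defect in the convexity inequality for the squared norm is exactly this
    nonnegative multiple of the squared distance.\<close>
  also have "\<dots> = (1 - t) * (x \<bullet> x) + t * (y \<bullet> y)
      - ((1 - t) *\<^sub>R x + t *\<^sub>R y) \<bullet> ((1 - t) *\<^sub>R x + t *\<^sub>R y)"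
    by (simp add: inner_simps inner_commute algebra_simps)
  finally show "((1 - t) *\<^sub>R x + t *\<^sub>R y) \<bullet> ((1 - t) *\<^sub>R x + t *\<^sub>R y)
      \<le> (1 - t) * (x \<bullet> x) + t * (y \<bullet> y)"
    by simp
qed (fact assms)

lemma convex_on_quadratic:
  fixes S :: "'a::real_inner set"
  assumes "convex S" "0 \<le> \<alpha>"
  shows "convex_on S (\<lambda>x. \<alpha> * (x \<bullet> x) + (a \<bullet> x + b))"
proof (rule convex_on_add)
  show "convex_on S (\<lambda>x. \<alpha> * (x \<bullet> x))"
    using assms by (intro convex_on_cmul convex_on_inner_self)
  show "convex_on S (\<lambda>x. a \<bullet> x + b)"
    by (rule convex_onI) (use assms in \<open>simp_all add: inner_simps algebra_simps\<close>)
qed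

text \<open>Add the maximality inequalities at the two stencil points. By the parallelogram law the
  squared norm has second difference exactly 2 along a unit vector, whatever the step, which
  produces the gain of 2 \<alpha>.\<close>

lemma second_diff_add_const_le:
  assumes x: "0 < step_factor \<T> \<delta> x" and "0 < \<delta>" and v: "norm v = 1"
    and max: "\<And>z. z = x + (step_factor \<T> \<delta> x * \<delta>) *\<^sub>R v \<or> z = x - (step_factor \<T> \<delta> x * \<delta>) *\<^sub>R v \<Longrightarrow>
      u z + \<alpha> * (z \<bullet> z) - w z \<le> u x + \<alpha> * (x \<bullet> x) - w x"
  shows "second_diff \<T> \<delta> u x v + 2 * \<alpha> \<le> second_diff \<T> \<delta> w x v"
proof -
  define s where "s = step_factor \<T> \<delta> x * \<delta>"
  have s: "0 < s" using x \<open>0 < \<delta>\<close> by (simp add: s_def)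
  let ?p = "x + s *\<^sub>R v" and ?m = "x - s *\<^sub>R v"
  have vv: "v \<bullet> v = 1" using v by (simp add: norm_eq_1)
  have "?p \<bullet> ?p + ?m \<bullet> ?m = 2 * (x \<bullet> x) + 2 * s\<^sup>2"
    by (simp add: inner_simps inner_commute vv power2_eq_square)
  then have "\<alpha> * (?p \<bullet> ?p) + \<alpha> * (?m \<bullet> ?m) = 2 * (\<alpha> * (x \<bullet> x)) + 2 * \<alpha> * s\<^sup>2"
    by (metis (no_types, opaque_lifting) distrib_left mult.assoc mult.left_commute)
  with max[of ?p] max[of ?m]
  have "u ?p - 2 * u x + u ?m + 2 * \<alpha> * s\<^sup>2 \<le> w ?p - 2 * w x + w ?m"
    by (simp add: s_def)
  then have "(u ?p - 2 * u x + u ?m + 2 * \<alpha> * s\<^sup>2) / s\<^sup>2 \<le> (w ?p - 2 * w x + w ?m) / s\<^sup>2"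
    by (intro divide_right_mono) auto
  then have "(u ?p - 2 * u x + u ?m) / s\<^sup>2 + 2 * \<alpha> \<le> (w ?p - 2 * w x + w ?m) / s\<^sup>2"
    using s by (simp add: add_divide_distrib)
  then show ?thesis
    by (simp add: second_diff_def Let_def s_def power_mult_distrib)
qed

text \<open>A \<open>GREATEST\<close> value can be used only once a largest admissible factor is
  known to exist. A ball around the node supplies an admissible factor, and closedness of the
  constraint makes the supremum attained.\<close>

lemma step_factor:
  fixes \<T> :: "(real^'n) set set"
  assumes x: "x \<in> mesh_domain \<T>" and \<delta>: "0 < \<delta>"
  shows "0 < step_factor \<T> \<delta> x" (is ?pos)
    and "\<forall>v\<in>sphere 0 1. x + (step_factor \<T> \<delta> x * \<delta>) *\<^sub>R v \<in> closure (mesh_domain \<T>) \<and>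
      x - (step_factor \<T> \<delta> x * \<delta>) *\<^sub>R v \<in> closure (mesh_domain \<T>)" (is ?adm)
proof -
  let ?C = "closure (mesh_domain \<T>)"
  define Q where "Q \<rho> \<longleftrightarrow> (\<forall>v\<in>sphere 0 1. x + (\<rho> * \<delta>) *\<^sub>R v \<in> ?C \<and> x - (\<rho> * \<delta>) *\<^sub>R v \<in> ?C)" for \<rho>
  obtain e where e: "0 < e" "ball x e \<subseteq> mesh_domain \<T>"
    using x open_interior unfolding mesh_domain_def by (meson openE)
  \<comment> \<open>The factor 2 keeps the stencil of radius at most \<open>e / 2\<close> strictly
    inside the open ball.\<close>
  define r where "r = min 1 (e / (2 * \<delta>))"
  have r: "0 < r" "r \<le> 1" using e \<delta> by (auto simp: r_def)
  have "r * \<delta> \<le> e / (2 * \<delta>) * \<delta>"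
    using \<delta> by (intro mult_right_mono) (auto simp: r_def)
  then have "r * \<delta> < e" using e \<delta> by simp
  then have "x + (r * \<delta>) *\<^sub>R v \<in> ?C \<and> x - (r * \<delta>) *\<^sub>R v \<in> ?C" if "v \<in> sphere 0 1" for v
    using that r \<delta>
    by (auto simp: dist_norm intro!: subsetD[OF closure_subset] subsetD[OF e(2)])
  then have Qr: "Q r" by (simp add: Q_def)
  have "{\<rho>. Q \<rho>} = (\<Inter>v\<in>sphere 0 1.
      (\<lambda>\<rho>. x + (\<rho> * \<delta>) *\<^sub>R v) -` ?C \<inter> (\<lambda>\<rho>. x - (\<rho> * \<delta>) *\<^sub>R v) -` ?C)"
    by (auto simp: Q_def)
  also have "closed \<dots>"
    by (intro closed_INT ballI closed_Int closed_vimage continuous_intros) auto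
  finally have "closed {\<rho>. Q \<rho>}" .
  \<comment> \<open>The condition \<open>0 < \<rho>\<close> is not closed. Cutting at
    \<open>r\<close> restores compactness and loses nothing, since factors below \<open>r\<close>
    cannot exceed the maximum.\<close>
  then have "compact ({r..1} \<inter> {\<rho>. Q \<rho>})"
    by (intro compact_Int_closed compact_Icc)
  moreover have "{r..1} \<inter> {\<rho>. Q \<rho>} \<noteq> {}" using r Qr by auto
  ultimately obtain m where m: "m \<in> {r..1}" "Q m" "\<And>\<rho>. \<rho> \<in> {r..1} \<Longrightarrow> Q \<rho> \<Longrightarrow> \<rho> \<le> m"
    using compact_attains_sup[of "{r..1} \<inter> {\<rho>. Q \<rho>}"] by (metis IntE IntI mem_Collect_eq)
  have "0 < step_factor \<T> \<delta> x \<and> Q (step_factor \<T> \<delta> x)"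
    unfolding step_factor_def Q_def[symmetric]
  proof (rule GreatestI2_order[where x = m])
    fix \<rho> assume *: "0 < \<rho> \<and> \<rho> \<le> 1 \<and> Q \<rho>"
    show "\<rho> \<le> m"
      using m(1) m(3)[of \<rho>] * by (cases "r \<le> \<rho>") auto
  qed (use m r in auto)
  then show ?pos ?adm by (auto simp: Q_def)
qed

section \<open>Mesh geometry and the maximum at a node\<close>

lemma
  fixes \<T> :: "(real^'n) set set"
  assumes "conforming_mesh \<T>"
  shows conforming_mesh_finite: "finite \<T>"
    and conforming_mesh_simplex: "K \<in> \<T> \<Longrightarrow> int CARD('n) simplex K"
  using assms by (auto simp: conforming_mesh_def triangulation_def)

text \<open>A full-dimensional simplex is contained in the closure of its interior, and a finite
  union of simplices is closed. The elementwise description of finite element functions thus covers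
  the whole closure.\<close>

lemma conforming_mesh_Union:
  fixes \<T> :: "(real^'n) set set"
  assumes "conforming_mesh \<T>"
  shows "closure (mesh_domain \<T>) = \<Union>\<T>"
proof
  have "closed (\<Union>\<T>)"
    using conforming_mesh_finite conforming_mesh_simplex closed_simplex assms by blast
  then show "closure (mesh_domain \<T>) \<subseteq> \<Union>\<T>"
    unfolding mesh_domain_def by (simp add: closure_minimal interior_subset)
  have "K \<subseteq> closure (mesh_domain \<T>)" if "K \<in> \<T>" for K
  proof -
    have K: "int CARD('n) simplex K" using assms that by (rule conforming_mesh_simplex)
    then have "aff_dim K = int DIM(real^'n)" by (simp add: aff_dim_simplex)
    then have "interior K = rel_interior K" by (simp add: interior_rel_interior_gen)
    moreover have "K \<noteq> {}" using K by auto
    ultimately have "interior K \<noteq> {}"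
      using K by (simp add: rel_interior_eq_empty convex_simplex)
    then have "K \<subseteq> closure (interior K)"
      using K by (simp add: convex_closure_interior convex_simplex closure_subset)
    also have "\<dots> \<subseteq> closure (mesh_domain \<T>)"
      unfolding mesh_domain_def using that by (intro closure_mono interior_mono) auto
    finally show ?thesis .
  qed
  then show "\<Union>\<T> \<subseteq> closure (mesh_domain \<T>)" by auto
qed

lemma interior_nodes_eq:
  assumes "conforming_mesh \<T>"
  shows "interior_nodes \<T> = nodes \<T> \<inter> mesh_domain \<T>"
proof -
  have "nodes \<T> \<subseteq> closure (mesh_domain \<T>)"
    unfolding conforming_mesh_Union[OF assms] by (auto simp: nodes_def extreme_point_of_def)
  moreover have "open (mesh_domain \<T>)" by (simp add: mesh_domain_def)
  ultimately show ?thesis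
    by (auto simp: interior_nodes_def boundary_nodes_def frontier_def interior_open)
qed

text \<open>Each element is the convex hull of its finitely many extreme points, so a convex
  function on it is bounded by its vertex values. The largest of the finitely many nodal values then
  bounds all of them.\<close>

lemma perturbed_max_at_node:
  fixes \<T> :: "(real^'n) set set"
  assumes mesh: "conforming_mesh \<T>" and fe: "u \<in> fe_space \<T>" "w \<in> fe_space \<T>" and "0 \<le> \<alpha>"
  defines "f \<equiv> \<lambda>x. u x + \<alpha> * (x \<bullet> x) - w x"
  obtains y where "y \<in> nodes \<T>" "\<And>x. x \<in> closure (mesh_domain \<T>) \<Longrightarrow> f x \<le> f y"
proof -
  have KM: "K = convex hull {x. x extreme_point_of K}" if "K \<in> \<T>" for K
    using conforming_mesh_simplex[OF mesh that]
    by (intro Krein_Milman_Minkowski compact_simplex convex_simplex)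
  have "finite {x. x extreme_point_of K}" if "K \<in> \<T>" for K
    using conforming_mesh_simplex[OF mesh that]
    by (intro finite_polyhedron_extreme_points simplex_imp_polyhedron)
  moreover have nodes_eq: "nodes \<T> = (\<Union>K\<in>\<T>. {x. x extreme_point_of K})"
    by (auto simp: nodes_def)
  ultimately have fin: "finite (nodes \<T>)"
    using conforming_mesh_finite[OF mesh] by simp
  have ne: "nodes \<T> \<noteq> {}"
  proof -
    obtain K where K: "K \<in> \<T>" using mesh by (auto simp: conforming_mesh_def)
    then have "K \<noteq> {}" using conforming_mesh_simplex[OF mesh K] by auto
    then have "{x. x extreme_point_of K} \<noteq> {}"
      using KM[OF K] by (metis convex_hull_empty)
    with K show ?thesis by (auto simp: nodes_eq)
  qed
  obtain y where y: "y \<in> nodes \<T>" "\<And>z. z \<in> nodes \<T> \<Longrightarrow> f z \<le> f y"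
    using Max_in[of "f ` nodes \<T>"] Max_ge[of "f ` nodes \<T>"] fin ne
    by (metis (no_types, lifting) finite_imageI image_iff image_is_empty)
  have "f x \<le> f y" if x: "x \<in> closure (mesh_domain \<T>)" for x
  proof -
    obtain K where K: "K \<in> \<T>" "x \<in> K" using x conforming_mesh_Union[OF mesh] by auto
    obtain a b where u: "\<And>x. x \<in> K \<Longrightarrow> u x = a \<bullet> x + b"
      using fe(1) K(1) by (fastforce simp: fe_space_def)
    obtain a' b' where w: "\<And>x. x \<in> K \<Longrightarrow> w x = a' \<bullet> x + b'"
      using fe(2) K(1) by (fastforce simp: fe_space_def)
    \<comment> \<open>On \<open>K\<close> the perturbed difference is this explicit quadratic, to
      which the convexity lemma applies directly.\<close>
    define g where "g = (\<lambda>x. \<alpha> * (x \<bullet> x) + ((a - a') \<bullet> x + (b - b')))"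
    have fg: "f x = g x" if "x \<in> K" for x
      using that by (simp add: f_def g_def u w inner_diff_left)
    have "convex_on K g"
      unfolding g_def using conforming_mesh_simplex[OF mesh K(1)] \<open>0 \<le> \<alpha>\<close>
      by (intro convex_on_quadratic convex_simplex)
    moreover have "g z \<le> f y" if "z extreme_point_of K" for z
      using that y(2)[of z] K(1) fg[of z] by (auto simp: nodes_def extreme_point_of_def)
    ultimately have "\<forall>x\<in>convex hull {x. x extreme_point_of K}. g x \<le> f y"
      by (intro convex_on_convex_hull_bound) (simp_all flip: KM[OF K(1)])
    then have "g x \<le> f y"
      using K(2) by (simp flip: KM[OF K(1)])
    then show ?thesis using fg K(2) by simp
  qed
  with y show thesis using that by blast
qed

section \<open>Monotonicity of the discrete operator\<close>

text \<open>The standard basis must be approximated by a member of the net. Without a member the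
  minimum over the net would be unspecified.\<close>

lemma basis_net_nonempty:
  fixes B :: "('n \<Rightarrow> real^'n) set"
  assumes "basis_net \<theta> S B"
  shows "B \<noteq> {}"
proof -
  have "range (\<lambda>i. axis i 1 :: real^'n) = Basis"
    by (auto simp: Basis_vec_def)
  then have "(\<lambda>i. axis i 1) \<in> (orthonormal_bases :: ('n \<Rightarrow> real^'n) set)"
    by (simp add: orthonormal_bases_def inner_axis_axis)
  then show ?thesis using assms by (auto simp: basis_net_def)
qed

lemma discrete_MA_le:
  assumes "finite B" "v \<in> B"
  shows "discrete_MA \<T> \<delta> B w x \<le> (\<Prod>j\<in>UNIV. second_diff_pos \<T> \<delta> w x (v j))
              - (\<Sum>j\<in>UNIV. second_diff_neg \<T> \<delta> w x (v j))"
  unfolding discrete_MA_def using assms by (intro Min_le) auto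

lemma discrete_MA_attained:
  assumes "finite B" "B \<noteq> {}"
  obtains v where "v \<in> B" "discrete_MA \<T> \<delta> B w x = (\<Prod>j\<in>UNIV. second_diff_pos \<T> \<delta> w x (v j))
              - (\<Sum>j\<in>UNIV. second_diff_neg \<T> \<delta> w x (v j))"
proof -
  have "discrete_MA \<T> \<delta> B w x \<in> (\<lambda>v. (\<Prod>j\<in>UNIV. second_diff_pos \<T> \<delta> w x (v j))
              - (\<Sum>j\<in>UNIV. second_diff_neg \<T> \<delta> w x (v j))) ` B"
    unfolding discrete_MA_def using assms by (intro Min_in) auto
  then show thesis using that by auto
qed

text \<open>One negative second difference annihilates the product and makes the subtracted sum
  positive, so the value for that basis, and with it the minimum, is negative.\<close>

lemma second_diff_nonneg:
  fixes B :: "('n \<Rightarrow> real^'n) set"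
  assumes "finite B" "v \<in> B" and MA: "0 \<le> discrete_MA \<T> \<delta> B w x"
  shows "0 \<le> second_diff \<T> \<delta> w x (v j)"
proof (rule ccontr)
  assume neg: "\<not> ?thesis"
  then have "(\<Prod>j\<in>UNIV. second_diff_pos \<T> \<delta> w x (v j)) = 0"
    by (intro prod_zero) (auto simp: second_diff_pos_def intro!: exI[of _ j])
  moreover have "0 < (\<Sum>j\<in>UNIV. second_diff_neg \<T> \<delta> w x (v j))"
    using neg by (intro sum_pos2[of _ j]) (auto simp: second_diff_neg_def)
  ultimately show False using MA discrete_MA_le[OF assms(1,2), of \<T> \<delta> w x] by linarith
qed

lemma discrete_MA_strict_mono:
  fixes B :: "('n \<Rightarrow> real^'n) set"
  assumes B: "finite B" "B \<noteq> {}" and MA: "0 \<le> discrete_MA \<T> \<delta> B u x"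
    and less: "\<And>v j. v \<in> B \<Longrightarrow> second_diff \<T> \<delta> u x (v j) < second_diff \<T> \<delta> w x (v j)"
  shows "discrete_MA \<T> \<delta> B u x < discrete_MA \<T> \<delta> B w x"
proof -
  \<comment> \<open>The basis is chosen minimal for \<open>w\<close>: the operator of
    \<open>u\<close> is bounded above by its value in any basis, so this one basis suffices.\<close>
  obtain v where v: "v \<in> B" and w: "discrete_MA \<T> \<delta> B w x =
      (\<Prod>j\<in>UNIV. second_diff_pos \<T> \<delta> w x (v j)) - (\<Sum>j\<in>UNIV. second_diff_neg \<T> \<delta> w x (v j))"
    using discrete_MA_attained[OF B] by blast
  have u0: "0 \<le> second_diff \<T> \<delta> u x (v j)" for j
    using B(1) v MA by (rule second_diff_nonneg)
  have w0: "0 < second_diff \<T> \<delta> w x (v j)" for j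
    using u0[of j] less[OF v, of j] by linarith
  have "discrete_MA \<T> \<delta> B u x \<le> (\<Prod>j\<in>UNIV. second_diff \<T> \<delta> u x (v j))"
    using discrete_MA_le[OF B(1) v, of \<T> \<delta> u x] u0
    by (simp add: second_diff_pos_def second_diff_neg_def max_absorb1 min_absorb2)
  also have "\<dots> < (\<Prod>j\<in>UNIV. second_diff \<T> \<delta> w x (v j))"
    \<comment> \<open>Factors for \<open>u\<close> may vanish, but all factors for \<open>w\<close>
      are positive, so the product inequality remains strict.\<close>
    by (rule prod_mono_strict) (use u0 w0 less[OF v] in \<open>auto simp: less_imp_le\<close>)
  also have "\<dots> = discrete_MA \<T> \<delta> B w x"
    using w0 by (simp add: w second_diff_pos_def second_diff_neg_def max_absorb1 min_absorb2 less_imp_le)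
  finally show ?thesis .
qed

section \<open>Comparison principle\<close>

theorem lemma2p4:
  fixes \<Omega> :: "(real^'n) set"
    and \<T> :: "(real^'n) set set"
    and S :: "(real^'n) set"
    and B :: "('n \<Rightarrow> real^'n) set"
    and u w :: "real^'n \<Rightarrow> real"
    and \<delta> \<theta> \<sigma> c :: real
  assumes dim: "CARD('n) \<ge> 2"
    and domain: "bounded \<Omega>" "uniformly_convex_domain \<Omega>"
    and mesh: "conforming_mesh \<T>" "shape_regular \<sigma> \<T>" "quasi_uniform c \<T>"
    and bdry_nodes: "boundary_nodes \<T> \<subseteq> frontier \<Omega>"
    and mesh_dom: "convex (mesh_domain \<T>)" "mesh_domain \<T> \<subseteq> \<Omega>"
    and params: "\<delta> > 0" "\<theta> > 0"
    and nets: "direction_net \<theta> S" "basis_net \<theta> S B"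
    and fe: "u \<in> fe_space \<T>" "w \<in> fe_space \<T>"
    and bdry: "\<And>x. x \<in> frontier (mesh_domain \<T>) \<Longrightarrow> u x \<le> w x"
    and oper: "\<And>x. x \<in> interior_nodes \<T> \<Longrightarrow>
                 discrete_MA \<T> \<delta> B u x \<ge> discrete_MA \<T> \<delta> B w x \<and> discrete_MA \<T> \<delta> B w x \<ge> 0"
  shows "\<forall>x\<in>mesh_domain \<T>. u x \<le> w x"
proof (intro ballI, rule ccontr)
  fix x\<^sub>0
  assume x0: "x\<^sub>0 \<in> mesh_domain \<T>" and "\<not> u x\<^sub>0 \<le> w x\<^sub>0"
  then have d: "0 < u x\<^sub>0 - w x\<^sub>0" by simp
  have "bounded (closure (mesh_domain \<T>))"
    using domain(1) mesh_dom(2) by (meson bounded_closure bounded_subset)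
  then obtain R where R: "0 < R" "\<And>x. x \<in> closure (mesh_domain \<T>) \<Longrightarrow> norm x \<le> R"
    using bounded_pos by metis
  \<comment> \<open>With this choice the perturbation is at most half the assumed gap throughout the
    closure.\<close>
  define \<alpha> where "\<alpha> = (u x\<^sub>0 - w x\<^sub>0) / (2 * R\<^sup>2)"
  have \<alpha>: "0 < \<alpha>" and \<alpha>R: "\<alpha> * R\<^sup>2 < u x\<^sub>0 - w x\<^sub>0"
    using d R(1) by (simp_all add: \<alpha>_def)
  obtain y where y: "y \<in> nodes \<T>" and max: "\<And>x. x \<in> closure (mesh_domain \<T>) \<Longrightarrow>
      u x + \<alpha> * (x \<bullet> x) - w x \<le> u y + \<alpha> * (y \<bullet> y) - w y"
    using perturbed_max_at_node[OF mesh(1) fe less_imp_le[OF \<alpha>]] by metis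
  \<comment> \<open>At a boundary node \<open>u y - w y\<close> is nonpositive, so the perturbed
    value is at most \<open>\<alpha> * R\<^sup>2\<close>. This is below the gap at
    \<open>x\<^sub>0\<close>, contradicting maximality.\<close>
  have "y \<in> interior_nodes \<T>"
  proof (rule ccontr)
    assume "y \<notin> interior_nodes \<T>"
    then have fr: "y \<in> frontier (mesh_domain \<T>)"
      using y by (auto simp: interior_nodes_def boundary_nodes_def)
    then have "norm y \<le> R" using R(2) by (simp add: frontier_def)
    then have "\<alpha> * (y \<bullet> y) \<le> \<alpha> * R\<^sup>2"
      using \<alpha> by (simp add: dot_square_norm power_mono)
    moreover have "0 \<le> \<alpha> * (x\<^sub>0 \<bullet> x\<^sub>0)" using \<alpha> by simp
    moreover have "x\<^sub>0 \<in> closure (mesh_domain \<T>)" using x0 closure_subset by blast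
    ultimately show False
      using max[of x\<^sub>0] bdry[OF fr] \<alpha>R by linarith
  qed
  then have yi: "y \<in> mesh_domain \<T>" and MA: "discrete_MA \<T> \<delta> B w y \<le> discrete_MA \<T> \<delta> B u y"
      "0 \<le> discrete_MA \<T> \<delta> B u y"
    using interior_nodes_eq[OF mesh(1)] oper[of y] by auto
  have "second_diff \<T> \<delta> u y (v j) < second_diff \<T> \<delta> w y (v j)" if v: "v \<in> B" for v j
  proof -
    have "v \<in> orthonormal_bases" using v nets(2) by (auto simp: basis_net_def)
    then have nv: "norm (v j) = 1" by (simp add: orthonormal_bases_def norm_eq_1)
    \<comment> \<open>The chosen step keeps both stencil points in the closure of the mesh domain,
      where maximality of \<open>y\<close> is available.\<close>
    then have "second_diff \<T> \<delta> u y (v j) + 2 * \<alpha> \<le> second_diff \<T> \<delta> w y (v j)"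
      using step_factor[OF yi params(1)] params(1) max
      by (intro second_diff_add_const_le) auto
    then show ?thesis using \<alpha> by linarith
  qed
  then have "discrete_MA \<T> \<delta> B u y < discrete_MA \<T> \<delta> B w y"
    using nets(2) MA(2) basis_net_nonempty[OF nets(2)]
    by (intro discrete_MA_strict_mono) (auto simp: basis_net_def)
  then show False using MA(1) by linarith
qed

end
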